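(* Let $(G,p)$ be an $r$-dimensional bar framework on $n$ vertices in $\mathbb{R}^r$, for some $r \leq n-2$. Suppose that the following two conditions hold. 1. $(G,p)$ has a positive semidefinite stress matrix $\Omega$ with rank $n-r-1$. 2. For each vertex $i$, the set $\{p^i\}\cup\{p^j : j\in N(i)\}$ affinely spans $\mathbb{R}^r$, where $N(i)$ is the set of nodes adjacent to $i$ in $G$. Then $(G,p)$ is universally rigid.
   Context: A bar framework $(G,p)$ in $\mathbb{R}^r$ is a simple connected graph $G=(V,E)$ with $V=\{1,\ldots,n\}$ together with a configuration $p=(p^1,\ldots,p^n)$ of points $p^i\in\mathbb{R}^r$ (all edges are regarded as bars). It is $r$-dimensional if $r$ is the dimension of the affine span of $p^1,\ldots,p^n$. $(G,p)$ is universally rigid if every $s$-dimensional bar framework $(G,q)$ in $\mathbb{R}^s$, for any $s$, with $\|q^i-q^j\|^2=\|p^i-p^j\|^2$ for all $\{i,j\}\in E$, is congruent to $(G,p)$, i.e., satisfies $\|q^i-q^j\|^2=\|p^i-p^j\|^2$ for all $i,j=1,\ldots,n$. A stress of $(G,p)$ is a function $\omega:E\to\mathbb{R}$ such that $\sum_{j:\{i,j\}\in E}\omega_{ij}(p^i-p^j)=0$ for all $i=1,\ldots,n$. The stress matrix associated with $\omega$ is the $n\times n$ symmetric matrix $\Omega$ with $\Omega_{ij}=-\omega_{ij}$ if $\{i,j\}\in E$, $\Omega_{ij}=0$ if $i\ne j$ and $\{i,j\}\notin E$, and $\Omega_{ii}=\sum_{k:\{i,k\}\in E}\omega_{ik}$.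 *)

theory Defs
  imports "Jordan_Normal_Form.DL_Rank"
begin

text \<open>
  Points of \<open>\<real>\<^sup>d\<close> are the elements of \<^term>\<open>carrier_vec d :: real vec set\<close>, so that the
  dimension (including 0) can be quantified over inside a definition. A graph on \<open>n\<close> vertices
  has vertex set \<^term>\<open>{..<n}\<close> (instead of \<open>1, \<dots>, n\<close>, to match matrix indices),
  and its edges are two-element sets of vertices.
\<close>

definition neighbours :: "nat \<Rightarrow> nat set set \<Rightarrow> nat \<Rightarrow> nat set" where
  "neighbours n E i = {j. j < n \<and> {i, j} \<in> E}"

definition simple_connected_graph :: "nat \<Rightarrow> nat set set \<Rightarrow> bool" where
  "simple_connected_graph n E \<longleftrightarrow>
     0 < n \<and>
     E \<subseteq> {{i, j} | i j. i < n \<and> j < n \<and> i \<noteq> j} \<and>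
     (\<forall>i<n. \<forall>j<n. (i, j) \<in> {(u, v). {u, v} \<in> E}\<^sup>*)"

definition affine_span :: "nat \<Rightarrow> real vec set \<Rightarrow> real vec set" where
  "affine_span d S =
     {finsum_vec TYPE(real) d (\<lambda>x. c x \<cdot>\<^sub>v x) T | c T. finite T \<and> T \<subseteq> S \<and> sum c T = 1}"

text \<open>
  The dimension of an affine subspace is the dimension of its direction space, which is the
  set of differences of its elements.
\<close>

definition affine_span_dim :: "nat \<Rightarrow> real vec set \<Rightarrow> nat" where
  "affine_span_dim d S =
     vectorspace.dim class_ring
       ((module_vec TYPE(real) d)
          \<lparr>carrier := {x - y | x y. x \<in> affine_span d S \<and> y \<in> affine_span d S}\<rparr>)"

definition bar_framework :: "nat \<Rightarrow> nat \<Rightarrow> nat set set \<Rightarrow> (nat \<Rightarrow> real vec) \<Rightarrow> bool" where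
  "bar_framework d n E p \<longleftrightarrow> simple_connected_graph n E \<and> (\<forall>i<n. p i \<in> carrier_vec d)"

definition framework_dim :: "nat \<Rightarrow> nat \<Rightarrow> (nat \<Rightarrow> real vec) \<Rightarrow> nat" where
  "framework_dim d n p = affine_span_dim d (p ` {..<n})"

definition sq_dist :: "real vec \<Rightarrow> real vec \<Rightarrow> real" where
  "sq_dist x y = (x - y) \<bullet> (x - y)"

definition universally_rigid :: "nat \<Rightarrow> nat set set \<Rightarrow> (nat \<Rightarrow> real vec) \<Rightarrow> bool" where
  "universally_rigid n E p \<longleftrightarrow>
     (\<forall>s q. bar_framework s n E q \<and> framework_dim s n q = s \<and>
        (\<forall>i<n. \<forall>j<n. {i, j} \<in> E \<longrightarrow> sq_dist (q i) (q j) = sq_dist (p i) (p j)) \<longrightarrow>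
        (\<forall>i<n. \<forall>j<n. sq_dist (q i) (q j) = sq_dist (p i) (p j)))"

text \<open>Only the values of \<open>\<omega>\<close> on \<open>E\<close> matter; \<open>\<omega> {i, j}\<close> is \<open>\<omega>\<^sub>i\<^sub>j\<close>.\<close>

definition is_stress ::
  "nat \<Rightarrow> nat \<Rightarrow> nat set set \<Rightarrow> (nat \<Rightarrow> real vec) \<Rightarrow> (nat set \<Rightarrow> real) \<Rightarrow> bool" where
  "is_stress d n E p \<omega> \<longleftrightarrow>
     (\<forall>i<n. finsum_vec TYPE(real) d (\<lambda>j. \<omega> {i, j} \<cdot>\<^sub>v (p i - p j)) (neighbours n E i) = 0\<^sub>v d)"

definition stress_matrix :: "nat \<Rightarrow> nat set set \<Rightarrow> (nat set \<Rightarrow> real) \<Rightarrow> real mat" where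
  "stress_matrix n E \<omega> =
     mat n n (\<lambda>(i, j).
       if i = j then \<Sum>k\<in>neighbours n E i. \<omega> {i, k}
       else if {i, j} \<in> E then - \<omega> {i, j}
       else 0)"

definition is_stress_matrix ::
  "nat \<Rightarrow> nat \<Rightarrow> nat set set \<Rightarrow> (nat \<Rightarrow> real vec) \<Rightarrow> real mat \<Rightarrow> bool" where
  "is_stress_matrix d n E p \<Omega> \<longleftrightarrow> (\<exists>\<omega>. is_stress d n E p \<omega> \<and> \<Omega> = stress_matrix n E \<omega>)"

definition pos_semidef :: "nat \<Rightarrow> real mat \<Rightarrow> bool" where
  "pos_semidef n A \<longleftrightarrow>
     A \<in> carrier_mat n n \<and> A\<^sup>T = A \<and> (\<forall>x\<in>carrier_vec n. 0 \<le> x \<bullet> (A *\<^sub>v x))"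

end

theory Submission
  imports Defs "Jordan_Normal_Form.Matrix_Kernel"
begin

text \<open>
  For a framework \<open>q\<close> with the same edge lengths, the stress energy
  \<open>\<Sum> \<omega>\<^sub>i\<^sub>j \<parallel>q\<^sub>i - q\<^sub>j\<parallel>\<^sup>2\<close> agrees with that of \<open>p\<close>, which is 0. As the stress matrix
  \<open>\<Omega>\<close> is positive semidefinite, every coordinate of \<open>q\<close> lies in its kernel; by the rank condition
  this kernel consists of the affine functions of \<open>p\<close>, so \<open>q\<^sub>i = b + A p\<^sub>i\<close>.

  The symmetric form \<open>B\<close> given by \<open>M = A\<^sup>T A - 1\<close> vanishes on all edge vectors, hence
  \<open>B(p\<^sub>i, p\<^sub>i) - B(p\<^sub>j, p\<^sub>j) = 2 B(p\<^sub>i, p\<^sub>i - p\<^sub>j)\<close> on edges, and the equilibrium condition puts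
  \<open>i \<mapsto> B(p\<^sub>i, p\<^sub>i)\<close> into the kernel of \<open>\<Omega>\<close>, too: \<open>B(p\<^sub>i, p\<^sub>i) = c + l \<bullet> p\<^sub>i\<close>. For fixed \<open>i\<close>
  the relation \<open>2 B(p\<^sub>i, x) = B(p\<^sub>i, p\<^sub>i) + c + l \<bullet> x\<close> is affine in \<open>x\<close> and holds at \<open>p\<^sub>i\<close> and
  its neighbours, hence everywhere, so \<open>2 M p\<^sub>i = l\<close> does not depend on \<open>i\<close>. Thus \<open>M\<close>
  annihilates all differences \<open>p\<^sub>i - p\<^sub>j\<close>, and all distances are preserved.
\<close>

section \<open>Rank, nullity and explicit bases of matrix kernels\<close>

text \<open>Independence in the kernel is independence in the ambient space, so it bounds
  cardinalities by \<open>nc\<close>; a maximal independent set is then a finite basis.\<close>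

lemma (in kernel) fin_dim_kernel: "Ker.fin_dim"
proof -
  let ?P = "\<lambda>S. S \<subseteq> mat_kernel A \<and> Ker.lin_indpt S"
  have small: "finite S \<and> card S \<le> nc" if "?P S" for S
    using that NC.li_le_dim[of S] mat_kernel_carrier[OF A] lindep_same[of S] NC.dim_is_n by auto
  have "?P {}" unfolding Ker.lin_dep_def by auto
  then obtain S where S: "finite S" "maximal S ?P"
    using maximal_exists[of ?P nc "{}"] small by blast
  then have "Ker.basis S" using Ker.max_li_is_basis[of S] by auto
  then show ?thesis unfolding Ker.fin_dim_def Ker.basis_def using S(1) by auto
qed

lemma mult_mat_vec_linear_map:
  fixes A :: "'a :: field mat"
  assumes A: "A \<in> carrier_mat nr nc"
  shows "linear_map class_ring (module_vec TYPE('a) nc) (module_vec TYPE('a) nr) (\<lambda>v. A *\<^sub>v v)"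
proof (rule linear_map.intro[OF vec_vs vec_vs], rule mod_hom.intro[OF vec_module vec_module], rule mod_hom_axioms.intro)
  show "(\<lambda>v. A *\<^sub>v v) \<in> LinearCombinations.module_hom class_ring (module_vec TYPE('a) nc) (module_vec TYPE('a) nr)"
    unfolding LinearCombinations.module_hom_def module_vec_simps class_ring_simps
    using mult_add_distrib_mat_vec[OF A] mult_mat_vec[OF A] A by auto
qed

lemma (in kernel) rank_nullity_mat: "vec_space.rank nr A + Ker.dim = nc"
proof -
  interpret NR: vec_space "TYPE('a)" nr .
  interpret lin: linear_map class_ring NC.V NR.V "\<lambda>v. A *\<^sub>v v"
    by (rule mult_mat_vec_linear_map[OF A])
  have im: "lin.im = NR.span (set (cols A))"
    using NR.col_space_eq[OF A] A unfolding lin.im_def NR.col_space_def by auto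
  have ker: "lin.ker = mat_kernel A"
    unfolding lin.ker_def mat_kernel[OF A] by auto
  show ?thesis
    using lin.rank_nullity unfolding im ker NR.rank_def by (simp add: NC.dim_is_n)
qed

lemma mult_unit_vec_eq_col:
  fixes A :: "'a :: semiring_1 mat"
  assumes "A \<in> carrier_mat nr nc" "i < nc"
  shows "A *\<^sub>v unit_vec nc i = col A i"
  using assms by auto

text \<open>By \<open>inj\<close> the \<open>m\<close> columns of \<open>W\<close> are independent,
  by \<open>AW\<close> they lie in the kernel, and by rank-nullity \<open>m\<close> is the nullity.
  So they form a basis.\<close>

lemma mat_kernel_eq_range:
  fixes A W :: "'a :: field mat"
  assumes A: "A \<in> carrier_mat nr n" and W: "W \<in> carrier_mat n m"
    and AW: "A * W = 0\<^sub>m nr m"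
    and inj: "\<And>c. c \<in> carrier_vec m \<Longrightarrow> W *\<^sub>v c = 0\<^sub>v n \<Longrightarrow> c = 0\<^sub>v m"
    and rank: "vec_space.rank nr A + m = n"
  shows "mat_kernel A = (\<lambda>c. W *\<^sub>v c) ` carrier_vec m"
proof -
  interpret kernel nr n A by unfold_locales (rule A)
  \<comment> \<open>Independence and dimension concern the set of columns, so coinciding columns
    must be excluded: they would make \<open>W\<close> annihilate a difference of two unit
    vectors.\<close>
  have "distinct (cols W)"
  proof (subst distinct_conv_nth, intro allI impI notI)
    fix i j assume ij: "i < length (cols W)" "j < length (cols W)" "i \<noteq> j"
      and eq: "cols W ! i = cols W ! j"
    with W have i: "i < m" and j: "j < m" by auto
    have "W *\<^sub>v (unit_vec m i - unit_vec m j) = W *\<^sub>v unit_vec m i - W *\<^sub>v unit_vec m j"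
      using W by (intro mult_minus_distrib_mat_vec) auto
    also have "\<dots> = 0\<^sub>v n" using eq ij W i j by (simp add: mult_unit_vec_eq_col minus_cancel_vec[OF col_carrier_vec])
    finally have "unit_vec m i - unit_vec m j = (0\<^sub>v m :: 'a vec)"
      by (intro inj) auto
    then have "(unit_vec m i - unit_vec m j) $ i = (0\<^sub>v m :: 'a vec) $ i" by simp
    then show False using i j ij(3) by simp
  qed
  have "NC.lin_indpt (set (cols W))"
  proof
    assume "NC.lin_dep (set (cols W))"
    from NC.lin_depE[OF W this \<open>distinct (cols W)\<close>] inj show False by metis
  qed
  moreover have sub: "set (cols W) \<subseteq> mat_kernel A"
  proof
    fix x assume "x \<in> set (cols W)"
    then obtain i where i: "i < m" "x = col W i" using W by (metis cols_length cols_nth in_set_conv_nth carrier_matD(2))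
    have "A *\<^sub>v x = col (A * W) i" using i A W by (metis col_mult2)
    also have "\<dots> = 0\<^sub>v nr" using i AW by auto
    finally show "x \<in> mat_kernel A" using i W A by (intro mat_kernelI[OF A]) auto
  qed
  ultimately have "Ker.lin_indpt (set (cols W))" using lindep_same by auto
  moreover have "card (set (cols W)) = m"
    using \<open>distinct (cols W)\<close> W by (simp add: distinct_card)
  ultimately have "Ker.basis (set (cols W))"
    using sub rank rank_nullity_mat fin_dim_kernel by (intro Ker.dim_li_is_basis) auto
  then have "mat_kernel A = NC.col_space W"
    unfolding Ker.basis_def NC.col_space_def using span_same[OF sub] by auto
  then show ?thesis using NC.col_space_eq[OF W] W by auto
qed

section \<open>Positive semidefinite forms and affine functions\<close>

lemma real_scalar_prod_self:
  fixes v :: "real vec"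
  shows "0 \<le> v \<bullet> v" and "v \<in> carrier_vec n \<Longrightarrow> v \<bullet> v = 0 \<longleftrightarrow> v = 0\<^sub>v n"
  by (auto simp: scalar_prod_def sum_nonneg sum_nonneg_eq_0_iff)

text \<open>The form vanishes at \<open>x\<close>; a small step from \<open>x\<close> in direction
  \<open>- (A *\<^sub>v x)\<close> would make it negative unless \<open>A *\<^sub>v x\<close> is
  zero.\<close>

lemma pos_semidef_kernelI:
  assumes psd: "pos_semidef n A" and x: "x \<in> carrier_vec n" and x0: "x \<bullet> (A *\<^sub>v x) = 0"
  shows "A *\<^sub>v x = 0\<^sub>v n"
proof -
  have A: "A \<in> carrier_mat n n" and sym: "A\<^sup>T = A"
    and nonneg: "\<And>x. x \<in> carrier_vec n \<Longrightarrow> 0 \<le> x \<bullet> (A *\<^sub>v x)"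
    using psd by (auto simp: pos_semidef_def)
  define y where "y = A *\<^sub>v x"
  have y: "y \<in> carrier_vec n" using A x by (simp add: y_def)
  have xAy: "x \<bullet> (A *\<^sub>v y) = y \<bullet> y"
    using transpose_vec_mult_scalar[OF A y x] sym A x y by (simp add: y_def)
  define a b where "a = y \<bullet> y" and "b = y \<bullet> (A *\<^sub>v y)"
  have a: "0 \<le> a" and b: "0 \<le> b"
    using nonneg[OF y] real_scalar_prod_self(1)[of y] by (auto simp: a_def b_def)
  \<comment> \<open>Along the step of length \<open>t\<close> the form is
    \<open>t\<^sup>2 * b - 2 * t * a\<close>. This choice makes it negative if \<open>a > 0\<close>;
    the summand 1 covers \<open>b = 0\<close>.\<close>
  define t where "t = a / (b + 1)"
  have at: "a = t * (b + 1)" using b by (simp add: t_def)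
  have "0 \<le> (x - t \<cdot>\<^sub>v y) \<bullet> (A *\<^sub>v (x - t \<cdot>\<^sub>v y))"
    using x y by (intro nonneg) auto
  also have "A *\<^sub>v (x - t \<cdot>\<^sub>v y) = y - t \<cdot>\<^sub>v (A *\<^sub>v y)"
    using A x y by (simp add: mult_minus_distrib_mat_vec mult_mat_vec y_def)
  also have "(x - t \<cdot>\<^sub>v y) \<bullet> (y - t \<cdot>\<^sub>v (A *\<^sub>v y)) = t\<^sup>2 * b - 2 * t * a"
    using A x y x0 xAy
    by (simp add: minus_scalar_prod_distrib[of _ n] scalar_prod_minus_distrib[of _ n] a_def b_def
        power2_eq_square algebra_simps flip: y_def)
  also have "\<dots> = - (t\<^sup>2 * (b + 2))"
    using at by (simp add: power2_eq_square algebra_simps)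
  finally have "t\<^sup>2 * (b + 2) \<le> 0" by simp
  then have "t = 0" using b by (simp add: mult_le_0_iff)
  then have "a = 0" using at by simp
  then show ?thesis using real_scalar_prod_self(2)[OF y] by (simp add: a_def y_def)
qed

lemma affine_zero_on_spanning_set:
  fixes l :: "real vec"
  assumes span: "affine_span d S = carrier_vec d" and S: "S \<subseteq> carrier_vec d"
    and l: "l \<in> carrier_vec d" and zero: "\<And>x. x \<in> S \<Longrightarrow> c + l \<bullet> x = 0"
  shows "c = 0" "l = 0\<^sub>v d"
proof -
  interpret vec_space "TYPE(real)" d .
  have *: "c + l \<bullet> x = 0" if "x \<in> carrier_vec d" for x
  proof -
    have "x \<in> affine_span d S" using that by (simp only: span)
    then obtain u T where T: "finite T" "T \<subseteq> S" "sum u T = 1"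
      and x: "x = finsum_vec TYPE(real) d (\<lambda>x. u x \<cdot>\<^sub>v x) T"
      unfolding affine_span_def mem_Collect_eq by (elim exE conjE)
    have Tc: "T \<subseteq> carrier_vec d" using T S by blast
    have "l \<bullet> x = x \<bullet> l" using l that by (simp add: comm_scalar_prod)
    also have "\<dots> = (\<Sum>x\<in>T. (u x \<cdot>\<^sub>v x) \<bullet> l)"
      unfolding x finsum_vec by (rule finsum_scalar_prod_sum) (use Tc l in auto)
    also have "\<dots> = (\<Sum>x\<in>T. u x * (l \<bullet> x))"
      using Tc l by (intro sum.cong) (auto simp: comm_scalar_prod[of _ d])
    also have "\<dots> = (\<Sum>x\<in>T. u x * (- c))"
    proof (intro sum.cong refl)
      fix x assume "x \<in> T"
      then have "l \<bullet> x = - c" using T zero[of x] by auto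
      then show "u x * (l \<bullet> x) = u x * (- c)" by simp
    qed
    also have "\<dots> = - c" using T(3) by (simp only: flip: sum_distrib_right)
    finally show ?thesis by simp
  qed
  \<comment> \<open>Having extended the identity to all points, evaluate it at the origin for
    \<open>c\<close>, and then at \<open>l\<close> itself, where it gives
    \<open>l \<bullet> l = 0\<close>.\<close>
  show c: "c = 0" using *[of "0\<^sub>v d"] l by simp
  show "l = 0\<^sub>v d" using *[OF l] c real_scalar_prod_self(2)[OF l] by simp
qed

section \<open>The stress matrix, its quadratic form and stress energy\<close>

locale stressed_framework =
  fixes n r :: nat and E :: "nat set set" and p :: "nat \<Rightarrow> real vec" and \<omega> :: "nat set \<Rightarrow> real"
  assumes framework: "bar_framework r n E p" and stress: "is_stress r n E p \<omega>"
begin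

abbreviation "N \<equiv> neighbours n E"
abbreviation "\<Omega> \<equiv> stress_matrix n E \<omega>"

lemma p_carrier [simp]: "i < n \<Longrightarrow> p i \<in> carrier_vec r"
  using framework by (simp add: bar_framework_def)

lemma finite_N [simp]: "finite (N i)"
  by (simp add: neighbours_def)

lemma N_less: "j \<in> N i \<Longrightarrow> j < n"
  by (simp add: neighbours_def)

lemma not_in_own_N [simp]: "i \<notin> N i"
proof
  assume "i \<in> N i"
  then have "{i} \<in> {{i, j} | i j. i < n \<and> j < n \<and> i \<noteq> j}"
    using framework unfolding bar_framework_def simple_connected_graph_def neighbours_def by auto
  then show False by (auto simp: doubleton_eq_iff)
qed

lemma \<Omega>_carrier [simp]: "\<Omega> \<in> carrier_mat n n"
  by (simp add: stress_matrix_def)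

lemma sum_N_swap: "(\<Sum>i<n. \<Sum>j\<in>N i. f i j) = (\<Sum>i<n. \<Sum>j\<in>N i. f j i)"
  using sum.swap_restrict[of "{..<n}" "{..<n}" f "\<lambda>i j. {i, j} \<in> E"]
  by (simp add: neighbours_def insert_commute)

text \<open>\<open>\<Omega>\<close> is a weighted graph Laplacian: the diagonal entry is the sum of
  the stresses at \<open>i\<close>, so each row combines into differences.\<close>

lemma \<Omega>_mult_index:
  assumes v: "v \<in> carrier_vec n" and i: "i < n"
  shows "(\<Omega> *\<^sub>v v) $ i = (\<Sum>j\<in>N i. \<omega> {i, j} * (v $ i - v $ j))"
proof -
  have "(\<Omega> *\<^sub>v v) $ i = (\<Sum>j<n. \<Omega> $$ (i, j) * v $ j)"
    using v i by (auto simp: stress_matrix_def scalar_prod_def atLeast0LessThan)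
  also have "\<dots> = \<Omega> $$ (i, i) * v $ i + (\<Sum>j\<in>{..<n} - {i}. \<Omega> $$ (i, j) * v $ j)"
    using i by (simp add: sum.remove)
  also have "(\<Sum>j\<in>{..<n} - {i}. \<Omega> $$ (i, j) * v $ j) = (\<Sum>j\<in>N i. - \<omega> {i, j} * v $ j)"
    using i not_in_own_N[of i]
    by (intro sum.mono_neutral_cong_right) (auto simp: stress_matrix_def neighbours_def)
  finally show ?thesis
    using i by (simp add: stress_matrix_def sum_distrib_right right_diff_distrib sum_subtractf sum_negf)
qed

text \<open>The equilibrium condition at \<open>i\<close>, tested against a direction
  \<open>u\<close>.\<close>

lemma stress_eq:
  assumes u: "u \<in> carrier_vec r" and i: "i < n"
  shows "(\<Sum>j\<in>N i. \<omega> {i, j} * (u \<bullet> (p i - p j))) = 0"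
proof -
  interpret vec_space "TYPE(real)" r .
  have "0 = finsum_vec TYPE(real) r (\<lambda>j. \<omega> {i, j} \<cdot>\<^sub>v (p i - p j)) (N i) \<bullet> u"
    using stress i u by (simp add: is_stress_def del: finsum_vec)
  also have "\<dots> = (\<Sum>j\<in>N i. (\<omega> {i, j} \<cdot>\<^sub>v (p i - p j)) \<bullet> u)"
    unfolding finsum_vec by (rule finsum_scalar_prod_sum) (use u i N_less in auto)
  also have "\<dots> = (\<Sum>j\<in>N i. \<omega> {i, j} * (u \<bullet> (p i - p j)))"
    using u i by (intro sum.cong) (auto simp: comm_scalar_prod[of _ r] dest: N_less)
  finally show ?thesis by simp
qed

text \<open>The double sum visits every edge from both ends, hence the factor 2; averaging the two
  orientations produces the square.\<close>

lemma quadratic_form_eq: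
  assumes v: "v \<in> carrier_vec n"
  shows "2 * (v \<bullet> (\<Omega> *\<^sub>v v)) = (\<Sum>i<n. \<Sum>j\<in>N i. \<omega> {i, j} * (v $ i - v $ j)\<^sup>2)"
proof -
  have *: "v \<bullet> (\<Omega> *\<^sub>v v) = (\<Sum>i<n. \<Sum>j\<in>N i. \<omega> {i, j} * (v $ i - v $ j) * v $ i)"
    using v \<Omega>_mult_index[OF v]
    by (simp add: scalar_prod_def atLeast0LessThan sum_distrib_left sum_distrib_right mult_ac carrier_matD[OF \<Omega>_carrier]
        del: index_mult_mat_vec)
  moreover have "v \<bullet> (\<Omega> *\<^sub>v v) = (\<Sum>i<n. \<Sum>j\<in>N i. \<omega> {i, j} * (v $ j - v $ i) * v $ j)"
    unfolding * by (subst sum_N_swap) (simp add: insert_commute)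
  ultimately have "2 * (v \<bullet> (\<Omega> *\<^sub>v v)) =
    (\<Sum>i<n. \<Sum>j\<in>N i. \<omega> {i, j} * (v $ i - v $ j) * v $ i + \<omega> {i, j} * (v $ j - v $ i) * v $ j)"
    by (simp add: sum.distrib)
  also have "\<dots> = (\<Sum>i<n. \<Sum>j\<in>N i. \<omega> {i, j} * (v $ i - v $ j)\<^sup>2)"
    by (intro sum.cong) (auto simp: algebra_simps power2_eq_square)
  finally show ?thesis .
qed

text \<open>Summing the quadratic form over the coordinate functions assembles squared distances.
  The dimension \<open>s\<close> is free, so this applies to \<open>p\<close> and to any competing
  \<open>q\<close>.\<close>

lemma energy_eq:
  assumes q: "\<And>i. i < n \<Longrightarrow> q i \<in> carrier_vec s"
  shows "2 * (\<Sum>k<s. vec n (\<lambda>i. q i $ k) \<bullet> (\<Omega> *\<^sub>v vec n (\<lambda>i. q i $ k))) =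
    (\<Sum>i<n. \<Sum>j\<in>N i. \<omega> {i, j} * sq_dist (q i) (q j))"
proof -
  have "2 * (\<Sum>k<s. vec n (\<lambda>i. q i $ k) \<bullet> (\<Omega> *\<^sub>v vec n (\<lambda>i. q i $ k))) =
    (\<Sum>k<s. \<Sum>i<n. \<Sum>j\<in>N i. \<omega> {i, j} * (q i $ k - q j $ k)\<^sup>2)"
    unfolding sum_distrib_left
    by (intro sum.cong refl) (auto simp: quadratic_form_eq dest: N_less intro!: sum.cong)
  also have "\<dots> = (\<Sum>i<n. \<Sum>k<s. \<Sum>j\<in>N i. \<omega> {i, j} * (q i $ k - q j $ k)\<^sup>2)"
    by (rule sum.swap)
  also have "\<dots> = (\<Sum>i<n. \<Sum>j\<in>N i. \<Sum>k<s. \<omega> {i, j} * (q i $ k - q j $ k)\<^sup>2)"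
    by (intro sum.cong refl sum.swap)
  also have "\<dots> = (\<Sum>i<n. \<Sum>j\<in>N i. \<omega> {i, j} * sq_dist (q i) (q j))"
  proof (intro sum.cong refl)
    fix i j assume "i \<in> {..<n}" "j \<in> N i"
    then have "q i \<in> carrier_vec s" "q j \<in> carrier_vec s" using q N_less by auto
    then show "(\<Sum>k<s. \<omega> {i, j} * (q i $ k - q j $ k)\<^sup>2) = \<omega> {i, j} * sq_dist (q i) (q j)"
      by (auto simp: sq_dist_def scalar_prod_def atLeast0LessThan power2_eq_square sum_distrib_left intro!: sum.cong)
  qed
  finally show ?thesis .
qed

text \<open>Constants cancel in the differences, and the linear part vanishes by
  equilibrium.\<close>

lemma \<Omega>_affine_function:
  assumes l: "l \<in> carrier_vec r"
  shows "\<Omega> *\<^sub>v vec n (\<lambda>i. c + l \<bullet> p i) = 0\<^sub>v n"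
proof (rule eq_vecI)
  fix i assume "i < dim_vec (0\<^sub>v n :: real vec)"
  then have i: "i < n" by simp
  have "(\<Omega> *\<^sub>v vec n (\<lambda>i. c + l \<bullet> p i)) $ i = (\<Sum>j\<in>N i. \<omega> {i, j} * (l \<bullet> (p i - p j)))"
    using l i by (subst \<Omega>_mult_index) (auto simp: scalar_prod_minus_distrib[of _ r] dest: N_less intro!: sum.cong)
  then show "(\<Omega> *\<^sub>v vec n (\<lambda>i. c + l \<bullet> p i)) $ i = 0\<^sub>v n $ i"
    using stress_eq[OF l i] i by simp
qed (simp add: stress_matrix_def)

section \<open>The kernel of the stress matrix and affine images\<close>

text \<open>Affine functions of \<open>p\<close> lie in the kernel. As the points affinely span,
  they form a space of dimension \<open>r + 1\<close>, which is the nullity.\<close>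

lemma \<Omega>_kernel_affine:
  assumes rank: "vec_space.rank n \<Omega> + (r + 1) = n"
    and span: "affine_span r (p ` {..<n}) = carrier_vec r"
    and v: "v \<in> carrier_vec n" and ker: "\<Omega> *\<^sub>v v = 0\<^sub>v n"
  obtains c l where "l \<in> carrier_vec r" "\<And>i. i < n \<Longrightarrow> v $ i = c + l \<bullet> p i"
proof -
  \<comment> \<open>Column 0 is the all-ones vector and column \<open>k + 1\<close> holds the
    \<open>k\<close>-th coordinates of the points, so \<open>W *\<^sub>v x\<close> is the affine
    function with constant \<open>x $ 0\<close> and the remaining entries as linear part.\<close>
  define W :: "real mat"
    where "W = mat n (Suc r) (\<lambda>(i, k). case k of 0 \<Rightarrow> 1 | Suc k \<Rightarrow> p i $ k)"
  have W: "W \<in> carrier_mat n (Suc r)" by (simp add: W_def)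
  have W_mult: "W *\<^sub>v x = vec n (\<lambda>i. x $ 0 + vec r (\<lambda>k. x $ Suc k) \<bullet> p i)"
    if "x \<in> carrier_vec (Suc r)" for x
  proof (rule eq_vecI)
    fix i assume "i < dim_vec (vec n (\<lambda>i. x $ 0 + vec r (\<lambda>k. x $ Suc k) \<bullet> p i))"
    then have i: "i < n" by simp
    then show "(W *\<^sub>v x) $ i = vec n (\<lambda>i. x $ 0 + vec r (\<lambda>k. x $ Suc k) \<bullet> p i) $ i"
      using that
      by (auto simp: W_def carrier_vecD[OF p_carrier[OF i]] scalar_prod_def sum.atLeast0_lessThan_Suc_shift mult.commute simp del: sum.op_ivl_Suc
          intro!: sum.cong)
  qed (simp add: W_def)
  have "mat_kernel \<Omega> = (\<lambda>c. W *\<^sub>v c) ` carrier_vec (Suc r)"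
  proof (rule mat_kernel_eq_range[OF \<Omega>_carrier W])
    show "\<Omega> * W = 0\<^sub>m n (Suc r)"
    proof (rule mat_col_eqI)
      fix k assume "k < dim_col (0\<^sub>m n (Suc r) :: real mat)"
      then have k: "k < Suc r" by simp
      have "col (\<Omega> * W) k = \<Omega> *\<^sub>v (W *\<^sub>v unit_vec (Suc r) k)"
        using col_mult2[OF \<Omega>_carrier W k] mult_unit_vec_eq_col[OF W k] by simp
      also have "\<dots> = 0\<^sub>v n"
        by (subst W_mult) (auto intro!: \<Omega>_affine_function)
      finally show "col (\<Omega> * W) k = col (0\<^sub>m n (Suc r)) k" using k by simp
    qed (use W in \<open>auto simp: stress_matrix_def\<close>)
    show "x = 0\<^sub>v (Suc r)" if x: "x \<in> carrier_vec (Suc r)" and 0: "W *\<^sub>v x = 0\<^sub>v n" for x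
    proof -
      have zero: "x $ 0 + vec r (\<lambda>k. x $ Suc k) \<bullet> y = 0" if y: "y \<in> p ` {..<n}" for y
      proof -
        from y obtain i where "i < n" "y = p i" by auto
        then show ?thesis using arg_cong[OF 0, of "\<lambda>v. v $ i"] by (simp add: W_mult[OF x])
      qed
      have "p ` {..<n} \<subseteq> carrier_vec r" by auto
      from affine_zero_on_spanning_set[OF span this _ zero]
      have "x $ 0 = 0" "vec r (\<lambda>k. x $ Suc k) = 0\<^sub>v r" by auto
      then have "x $ k = 0" if "k < Suc r" for k
        using that by (cases k) (auto simp: vec_eq_iff)
      then show ?thesis using x by auto
    qed
  qed (use rank in simp)
  moreover have "v \<in> mat_kernel \<Omega>" using v ker by (intro mat_kernelI[OF \<Omega>_carrier])
  ultimately obtain x where "x \<in> carrier_vec (Suc r)" "v = W *\<^sub>v x" by auto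
  then show ?thesis using W_mult by (intro that[of "vec r (\<lambda>k. x $ Suc k)" "x $ 0"]) auto
qed

lemma affine_map_of_equivalent_framework:
  assumes psd: "pos_semidef n \<Omega>"
    and rank: "vec_space.rank n \<Omega> + (r + 1) = n"
    and span: "affine_span r (p ` {..<n}) = carrier_vec r"
    and q: "\<And>i. i < n \<Longrightarrow> q i \<in> carrier_vec s"
    and dist: "\<And>i j. i < n \<Longrightarrow> j \<in> N i \<Longrightarrow> sq_dist (q i) (q j) = sq_dist (p i) (p j)"
  obtains A b where "A \<in> carrier_mat s r" "b \<in> carrier_vec s"
    "\<And>i. i < n \<Longrightarrow> q i = b + A *\<^sub>v p i"
proof -
  let ?v = "\<lambda>q k. vec n (\<lambda>i. q i $ k) :: real vec"
  \<comment> \<open>Coordinates are affine functions, with a unit vector as linear part; hence the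
    energy of \<open>p\<close> is zero.\<close>
  have p_kernel: "\<Omega> *\<^sub>v ?v p k = 0\<^sub>v n" if "k < r" for k
  proof -
    have "?v p k = vec n (\<lambda>i. 0 + unit_vec r k \<bullet> p i)"
      using that p_carrier by auto
    then show ?thesis by (simp only: \<Omega>_affine_function unit_vec_carrier)
  qed
  have "2 * (\<Sum>k<s. ?v q k \<bullet> (\<Omega> *\<^sub>v ?v q k)) = (\<Sum>i<n. \<Sum>j\<in>N i. \<omega> {i, j} * sq_dist (q i) (q j))"
    using q by (rule energy_eq)
  also have "\<dots> = (\<Sum>i<n. \<Sum>j\<in>N i. \<omega> {i, j} * sq_dist (p i) (p j))"
    using dist by simp
  also have "\<dots> = 2 * (\<Sum>k<r. ?v p k \<bullet> (\<Omega> *\<^sub>v ?v p k))"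
    by (rule energy_eq[symmetric]) simp
  also have "\<dots> = 0" using p_kernel by simp
  finally have "(\<Sum>k<s. ?v q k \<bullet> (\<Omega> *\<^sub>v ?v q k)) = 0" by simp
  \<comment> \<open>A vanishing sum of nonnegative terms forces each coordinate of \<open>q\<close>
    to have zero energy.\<close>
  moreover have "0 \<le> ?v q k \<bullet> (\<Omega> *\<^sub>v ?v q k)" for k
    using psd by (simp add: pos_semidef_def)
  ultimately have "?v q k \<bullet> (\<Omega> *\<^sub>v ?v q k) = 0" if "k < s" for k
    using that by (simp add: sum_nonneg_eq_0_iff)
  then have "\<Omega> *\<^sub>v ?v q k = 0\<^sub>v n" if "k < s" for k
    using that by (intro pos_semidef_kernelI[OF psd]) auto
  then have "\<exists>c l. l \<in> carrier_vec r \<and> (\<forall>i<n. ?v q k $ i = c + l \<bullet> p i)" if "k < s" for k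
    using that \<Omega>_kernel_affine[OF rank span, of "?v q k"] by (metis vec_carrier)
  then obtain c l where cl: "\<And>k. k < s \<Longrightarrow> l k \<in> carrier_vec r \<and> (\<forall>i<n. q i $ k = c k + l k \<bullet> p i)"
    by simp metis
  define A where "A = mat_of_rows r (map l [0..<s])"
  have "q i = vec s c + A *\<^sub>v p i" if "i < n" for i
    using that q[OF that] cl by (intro eq_vecI) (auto simp: A_def)
  then show ?thesis by (intro that[of A "vec s c"]) (auto simp: A_def)
qed

text \<open>In projective terms, the edge directions lie on no conic at infinity: as the points
  affinely span, the conclusion amounts to \<open>M\<close> being zero.\<close>

lemma no_nontrivial_edge_form:
  assumes rank: "vec_space.rank n \<Omega> + (r + 1) = n"
    and span: "affine_span r (p ` {..<n}) = carrier_vec r"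
    and spans: "\<And>i. i < n \<Longrightarrow> affine_span r ({p i} \<union> p ` N i) = carrier_vec r"
    and M: "M \<in> carrier_mat r r" and sym: "M\<^sup>T = M"
    and edge: "\<And>i j. i < n \<Longrightarrow> j \<in> N i \<Longrightarrow> (p i - p j) \<bullet> (M *\<^sub>v (p i - p j)) = 0"
    and i: "i < n" and j: "j < n"
  shows "M *\<^sub>v p i = M *\<^sub>v p j"
proof -
  define B where "B x y = (M *\<^sub>v x) \<bullet> y" for x y
  have B_sym: "B x y = B y x" if "x \<in> carrier_vec r" "y \<in> carrier_vec r" for x y
    using that transpose_vec_mult_scalar[OF M that(2,1)] M sym
    by (simp add: B_def comm_scalar_prod[of "M *\<^sub>v x" r y] comm_scalar_prod[of "M *\<^sub>v y" r x])
  have B_edge: "B (p i) (p i) + B (p j) (p j) = 2 * B (p i) (p j)" if "i < n" "j \<in> N i" for i j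
  proof -
    have pij: "p i \<in> carrier_vec r" "p j \<in> carrier_vec r" using that N_less by auto
    have "0 = (M *\<^sub>v (p i - p j)) \<bullet> (p i - p j)"
      using edge[OF that] pij M by (simp add: comm_scalar_prod[of _ r])
    also have "\<dots> = B (p i) (p i) - B (p i) (p j) - (B (p j) (p i) - B (p j) (p j))"
      using pij M by (simp add: B_def mult_minus_distrib_mat_vec minus_scalar_prod_distrib[of _ r]
          scalar_prod_minus_distrib[of _ r])
    finally show ?thesis using B_sym[OF pij] by simp
  qed
  define a where "a = vec n (\<lambda>i. B (p i) (p i))"
  have "\<Omega> *\<^sub>v a = 0\<^sub>v n"
  proof (rule eq_vecI)
    fix i assume "i < dim_vec (0\<^sub>v n :: real vec)"
    then have i: "i < n" by simp
    have "(\<Omega> *\<^sub>v a) $ i = (\<Sum>j\<in>N i. \<omega> {i, j} * (a $ i - a $ j))"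
      using i by (intro \<Omega>_mult_index) (auto simp: a_def)
    \<comment> \<open>The edge relation replaces the quadratic difference by one linear in
      \<open>p i - p j\<close>, with \<open>M *\<^sub>v p i\<close> fixed, so that equilibrium
      applies.\<close>
    also have "\<dots> = (\<Sum>j\<in>N i. 2 * (\<omega> {i, j} * ((M *\<^sub>v p i) \<bullet> (p i - p j))))"
    proof (intro sum.cong refl)
      fix j assume j: "j \<in> N i"
      then have "a $ i - a $ j = 2 * (B (p i) (p i) - B (p i) (p j))"
        using B_edge[OF i j] i N_less[OF j] by (simp add: a_def)
      also have "B (p i) (p i) - B (p i) (p j) = (M *\<^sub>v p i) \<bullet> (p i - p j)"
        using M i N_less[OF j] by (simp add: B_def scalar_prod_minus_distrib[of _ r])
      finally show "\<omega> {i, j} * (a $ i - a $ j) = 2 * (\<omega> {i, j} * ((M *\<^sub>v p i) \<bullet> (p i - p j)))"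
        by simp
    qed
    also have "\<dots> = 0" using M i by (simp add: stress_eq flip: sum_distrib_left)
    finally show "(\<Omega> *\<^sub>v a) $ i = 0\<^sub>v n $ i" using i by simp
  qed (simp add: stress_matrix_def)
  moreover have "a \<in> carrier_vec n" by (simp add: a_def)
  ultimately obtain c l where l: "l \<in> carrier_vec r" and "\<And>i. i < n \<Longrightarrow> a $ i = c + l \<bullet> p i"
    using \<Omega>_kernel_affine[OF rank span] by metis
  then have a: "B (p i) (p i) = c + l \<bullet> p i" if "i < n" for i
    using that by (simp add: a_def)
  have "2 \<cdot>\<^sub>v (M *\<^sub>v p i) = l" if i: "i < n" for i
  proof -
    let ?d = "l - 2 \<cdot>\<^sub>v (M *\<^sub>v p i)"
    \<comment> \<open>At a neighbour this is the edge relation with \<open>B x x\<close> rewritten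
      as \<open>c + l \<bullet> x\<close>; at \<open>p i\<close> it is that rewriting alone.\<close>
    have zero: "(B (p i) (p i) + c) + ?d \<bullet> x = 0" if x: "x \<in> {p i} \<union> p ` N i" for x
    proof -
      have xc: "x \<in> carrier_vec r" using x i N_less by auto
      have "B (p i) (p i) + (c + l \<bullet> x) = 2 * B (p i) x"
        using x a[OF i] a[OF N_less] B_edge[OF i] by auto
      moreover have "?d \<bullet> x = l \<bullet> x - 2 * B (p i) x"
        using l M i xc by (simp add: B_def minus_scalar_prod_distrib[of _ r])
      ultimately show ?thesis by simp
    qed
    have "?d = 0\<^sub>v r"
      using affine_zero_on_spanning_set(2)[OF spans[OF i] _ _ zero] l M i N_less by fastforce
    then have "?d $ k = 0" if "k < r" for k using that by simp
    then show ?thesis using l M i by (intro eq_vecI) auto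
  qed
  from this[OF i] this[OF j] have "2 \<cdot>\<^sub>v (M *\<^sub>v p i) = 2 \<cdot>\<^sub>v (M *\<^sub>v p j)" by simp
  then have "(1 / 2) \<cdot>\<^sub>v (2 \<cdot>\<^sub>v (M *\<^sub>v p i)) = (1 / 2) \<cdot>\<^sub>v (2 \<cdot>\<^sub>v (M *\<^sub>v p j))" by simp
  then show ?thesis by (simp add: smult_smult_assoc)
qed

end

section \<open>Distances under affine maps and universal rigidity\<close>

lemma affine_span_carrier:
  assumes "S \<subseteq> carrier_vec d"
  shows "affine_span d S \<subseteq> carrier_vec d"
proof -
  interpret vec_space "TYPE(real)" d .
  show ?thesis
    unfolding affine_span_def finsum_vec using assms by (auto intro!: finsum_closed)
qed

lemma affine_span_mono: "S \<subseteq> T \<Longrightarrow> affine_span d S \<subseteq> affine_span d T"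
  unfolding affine_span_def by blast

text \<open>The translation cancels; the deviation of \<open>A\<^sup>T * A\<close> from the identity
  measures the change of squared length.\<close>

lemma sq_dist_affine_map:
  assumes A: "A \<in> carrier_mat s r" and b: "b \<in> carrier_vec s"
    and x: "x \<in> carrier_vec r" and y: "y \<in> carrier_vec r"
  shows "sq_dist (b + A *\<^sub>v x) (b + A *\<^sub>v y) =
    sq_dist x y + (x - y) \<bullet> ((A\<^sup>T * A - 1\<^sub>m r) *\<^sub>v (x - y))"
proof -
  define d where "d = x - y"
  have d: "d \<in> carrier_vec r" using x y by (simp add: d_def)
  have M: "A\<^sup>T * A - 1\<^sub>m r \<in> carrier_mat r r" using A by (simp add: minus_carrier_mat)
  have Ad: "A *\<^sub>v d \<in> carrier_vec s" using A d by simp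
  have "(b + A *\<^sub>v x) - (b + A *\<^sub>v y) = A *\<^sub>v x - A *\<^sub>v y"
    using A b x y by (intro eq_vecI) auto
  also have "\<dots> = A *\<^sub>v d"
    using A x y by (simp add: d_def mult_minus_distrib_mat_vec)
  finally have "sq_dist (b + A *\<^sub>v x) (b + A *\<^sub>v y) = (A *\<^sub>v d) \<bullet> (A *\<^sub>v d)"
    by (simp add: sq_dist_def)
  also have "\<dots> = d \<bullet> (A\<^sup>T *\<^sub>v (A *\<^sub>v d))"
    using transpose_vec_mult_scalar[OF A d Ad] A d Ad by (simp add: comm_scalar_prod[of d r])
  also have "A\<^sup>T *\<^sub>v (A *\<^sub>v d) = d + (A\<^sup>T * A - 1\<^sub>m r) *\<^sub>v d"
    using A d by (simp add: minus_mult_distrib_mat_vec[of _ r r] assoc_mult_mat_vec[of _ r s _ r]) auto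
  also have "d \<bullet> \<dots> = d \<bullet> d + d \<bullet> ((A\<^sup>T * A - 1\<^sub>m r) *\<^sub>v d)"
    using M d by (intro scalar_prod_add_distrib[of _ r]) auto
  finally show ?thesis by (simp add: sq_dist_def d_def)
qed

theorem theorem2p2:
  fixes n r :: nat
    and E :: "nat set set"
    and p :: "nat \<Rightarrow> real vec"
  assumes framework: "bar_framework r n E p"
    and dim: "framework_dim r n p = r"
    and r_le: "r + 2 \<le> n"
    and stress: "\<exists>\<Omega>. is_stress_matrix r n E p \<Omega> \<and> pos_semidef n \<Omega> \<and> vec_space.rank n \<Omega> = n - r - 1"
    and spans: "\<And>i. i < n \<Longrightarrow> affine_span r ({p i} \<union> p ` neighbours n E i) = carrier_vec r"
  shows "universally_rigid n E p"
proof -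
  from stress obtain \<omega> where \<omega>: "is_stress r n E p \<omega>" and psd: "pos_semidef n (stress_matrix n E \<omega>)"
    and rank: "vec_space.rank n (stress_matrix n E \<omega>) = n - r - 1"
    unfolding is_stress_matrix_def by auto
  interpret stressed_framework n r E p \<omega>
    by (rule stressed_framework.intro[OF framework \<omega>])
  \<comment> \<open>The bound on \<open>n\<close> makes the truncated subtraction
    \<open>n - r - 1\<close> exact.\<close>
  have rank': "vec_space.rank n \<Omega> + (r + 1) = n" using rank r_le by simp
  have "0 < n" using r_le by simp
  \<comment> \<open>Vertex 0 and its neighbours already span the whole space.\<close>
  have span: "affine_span r (p ` {..<n}) = carrier_vec r"
  proof
    show "affine_span r (p ` {..<n}) \<subseteq> carrier_vec r"
      by (rule affine_span_carrier) auto
    have "affine_span r ({p 0} \<union> p ` N 0) \<subseteq> affine_span r (p ` {..<n})"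
      using \<open>0 < n\<close> N_less by (intro affine_span_mono) auto
    then show "carrier_vec r \<subseteq> affine_span r (p ` {..<n})"
      using spans[OF \<open>0 < n\<close>] by simp
  qed
  show ?thesis
    unfolding universally_rigid_def
  proof (intro allI impI, elim conjE)
    fix s q i j
    assume "bar_framework s n E q" and i: "i < n" and j: "j < n"
      and dist: "\<forall>i<n. \<forall>j<n. {i, j} \<in> E \<longrightarrow> sq_dist (q i) (q j) = sq_dist (p i) (p j)"
    then have q: "\<And>i. i < n \<Longrightarrow> q i \<in> carrier_vec s" by (simp add: bar_framework_def)
    have distN: "sq_dist (q i) (q j) = sq_dist (p i) (p j)" if "i < n" "j \<in> N i" for i j
      using that dist by (simp add: neighbours_def)
    obtain A b where A: "A \<in> carrier_mat s r" and b: "b \<in> carrier_vec s"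
      and qA: "\<And>i. i < n \<Longrightarrow> q i = b + A *\<^sub>v p i"
      using affine_map_of_equivalent_framework[OF psd rank' span q distN] by blast
    define M where "M = A\<^sup>T * A - 1\<^sub>m r"
    have M: "M \<in> carrier_mat r r" using A by (simp add: M_def minus_carrier_mat)
    have sym: "M\<^sup>T = M"
      using A by (simp add: M_def transpose_minus[of _ r r] transpose_mult[of _ r s])
    have dist_M: "sq_dist (q i) (q j) = sq_dist (p i) (p j) + (p i - p j) \<bullet> (M *\<^sub>v (p i - p j))"
      if "i < n" "j < n" for i j
      using that by (simp add: qA M_def sq_dist_affine_map[OF A b])
    \<comment> \<open>On edges, equal lengths and \<open>dist_M\<close> leave exactly the vanishing
      of the form.\<close>
    have "M *\<^sub>v p i = M *\<^sub>v p j"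
      using distN dist_M[OF _ N_less]
      by (intro no_nontrivial_edge_form[OF rank' span spans M sym _ i j]) auto
    then have "M *\<^sub>v (p i - p j) = 0\<^sub>v r"
      using M i j by (simp add: mult_minus_distrib_mat_vec)
    then show "sq_dist (q i) (q j) = sq_dist (p i) (p j)"
      using dist_M[OF i j] i j by simp
  qed
qed

end
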